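(* Let $\Delta$ be a loopless matroid of rank $c$ on $[n]$ with $c<n$. Let $g$ be the girth of $\Delta$, i.e. the minimal size of a circuit of $\Delta$. Then the uniformity threshold of $\Delta$ is $\operatorname{ut}(\Delta)=c+2-g$.
   Context: A matroid on $[n]$ is identified with the simplicial complex whose facets are its bases. For a pure simplicial complex $\Delta$ on $[n]$ of dimension $c-1$ (facets of size $c\ge 1$), the uniformity threshold $\operatorname{ut}(\Delta)$ is the minimum integer $u$ with $1\le u\le c$ such that the codimension-$(u-1)$ skeleton of $\Delta$, i.e. the complex of all faces of $\Delta$ of size at most $c-u+1$, is (the independence complex of) a uniform matroid on $[n]$, i.e. consists of all subsets of $[n]$ of size at most $c-u+1$; if no such $u$ exists, $\operatorname{ut}(\Delta)=\infty$. *)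

theory Defs
  imports Main "HOL-Library.Extended_Nat"
begin

text \<open>
  The vertex set \<open>[n]\<close> is \<open>{1..n}\<close>. Complexes are given by their set of faces, and not
  every element of \<open>[n]\<close> has to be a face.
\<close>

definition simplicial_complex :: "nat \<Rightarrow> nat set set \<Rightarrow> bool" where
  "simplicial_complex n \<Delta> \<longleftrightarrow> \<Delta> \<subseteq> Pow {1..n} \<and> (\<forall>F\<in>\<Delta>. \<forall>G\<subseteq>F. G \<in> \<Delta>)"

definition facet :: "nat set set \<Rightarrow> nat set \<Rightarrow> bool" where
  "facet \<Delta> F \<longleftrightarrow> F \<in> \<Delta> \<and> (\<forall>G\<in>\<Delta>. F \<subseteq> G \<longrightarrow> G = F)"

text \<open>
  A matroid is identified with its independence complex; its bases are the facets.
\<close>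

definition matroid :: "nat \<Rightarrow> nat set set \<Rightarrow> bool" where
  "matroid n \<Delta> \<longleftrightarrow> simplicial_complex n \<Delta> \<and> {} \<in> \<Delta> \<and>
     (\<forall>I\<in>\<Delta>. \<forall>J\<in>\<Delta>. card I < card J \<longrightarrow> (\<exists>x\<in>J - I. insert x I \<in> \<Delta>))"

definition loopless :: "nat \<Rightarrow> nat set set \<Rightarrow> bool" where
  "loopless n \<Delta> \<longleftrightarrow> (\<forall>i\<in>{1..n}. {i} \<in> \<Delta>)"

text \<open>
  The dimension plus one. For a pure complex this is the common size of the facets, hence for a
  matroid it is the size of the bases; see \<open>matroid_card_facet\<close> below.
\<close>

definition complex_rank :: "nat set set \<Rightarrow> nat" where
  "complex_rank \<Delta> = Max (card ` \<Delta>)"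

definition circuit :: "nat \<Rightarrow> nat set set \<Rightarrow> nat set \<Rightarrow> bool" where
  "circuit n \<Delta> C \<longleftrightarrow> C \<subseteq> {1..n} \<and> C \<notin> \<Delta> \<and> (\<forall>D. D \<subset> C \<longrightarrow> D \<in> \<Delta>)"

text \<open>
  Meaningful only if there is a circuit, that is, if the rank is smaller than \<open>n\<close>.
\<close>

definition girth :: "nat \<Rightarrow> nat set set \<Rightarrow> nat" where
  "girth n \<Delta> = Min (card ` {C. circuit n \<Delta> C})"

definition uniform_matroid :: "nat \<Rightarrow> nat \<Rightarrow> nat set set" where
  "uniform_matroid n r = {F. F \<subseteq> {1..n} \<and> card F \<le> r}"

definition codim_skeleton :: "nat \<Rightarrow> nat set set \<Rightarrow> nat set set" where
  "codim_skeleton k \<Delta> = {F \<in> \<Delta>. card F \<le> complex_rank \<Delta> - k}"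

text \<open>
  The infimum of the empty set in \<^typ>\<open>enat\<close> is \<open>\<infinity>\<close>; a nonempty one is attained. The
  subtractions do not truncate, because \<open>1 \<le> u \<le> complex_rank \<Delta>\<close>.
\<close>

definition uniformity_threshold :: "nat \<Rightarrow> nat set set \<Rightarrow> enat" where
  "uniformity_threshold n \<Delta> =
     Inf {enat u | u. 1 \<le> u \<and> u \<le> complex_rank \<Delta> \<and>
       codim_skeleton (u - 1) \<Delta> = uniform_matroid n (complex_rank \<Delta> - u + 1)}"

lemma matroid_card_facet:
  assumes "matroid n \<Delta>" and "facet \<Delta> B"
  shows "card B = complex_rank \<Delta>"
proof -
  have fin: "finite \<Delta>"
    using assms(1) unfolding matroid_def simplicial_complex_def
    by (meson finite_Pow_iff finite_atLeastAtMost finite_subset)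
  have B: "B \<in> \<Delta>" using assms(2) by (simp add: facet_def)
  have "card J \<le> card B" if J: "J \<in> \<Delta>" for J
  proof (rule ccontr)
    assume "\<not> card J \<le> card B"
    then obtain x where "x \<in> J - B" "insert x B \<in> \<Delta>"
      using assms(1) B J unfolding matroid_def by (meson not_le)
    then show False using assms(2) unfolding facet_def by blast
  qed
  then show ?thesis
    unfolding complex_rank_def using fin B by (intro Max_eqI[symmetric]) auto
qed

end

theory Submission
  imports Defs
begin

text \<open>
  All sets of size at most \<open>r\<close> are faces exactly when \<open>r\<close> is smaller than the girth, because a
  set is a face exactly when it contains no circuit. For \<open>r = c - u + 1\<close> this says
  \<open>u \<ge> c + 2 - g\<close>, and this bound lies between \<open>1\<close> and \<open>c\<close>: some set of size \<open>c + 1\<close> is dependent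
  (as \<open>c < n\<close>), and no circuit has size at most \<open>1\<close> (as there are no loops).
\<close>

lemma finite_simplicial_complex: "simplicial_complex n \<Delta> \<Longrightarrow> finite \<Delta>"
  unfolding simplicial_complex_def by (meson finite_Pow_iff finite_atLeastAtMost finite_subset)

lemma card_le_complex_rank:
  assumes "simplicial_complex n \<Delta>" and "F \<in> \<Delta>"
  shows "card F \<le> complex_rank \<Delta>"
  unfolding complex_rank_def using assms finite_simplicial_complex by (intro Max_ge) auto

lemma finite_circuits: "finite {C. circuit n \<Delta> C}"
  by (rule finite_subset[of _ "Pow {1..n}"]) (auto simp: circuit_def)

lemma girth_le_card: "circuit n \<Delta> C \<Longrightarrow> girth n \<Delta> \<le> card C"
  unfolding girth_def by (intro Min_le) (auto simp: finite_circuits)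

text \<open>Descending through proper subsets that are still nonfaces must stop, and it stops at a
  minimal nonface, which is a circuit.\<close>

lemma nonface_contains_circuit:
  assumes "F \<subseteq> {1..n}" and "F \<notin> \<Delta>"
  obtains C where "circuit n \<Delta> C" and "C \<subseteq> F"
proof -
  have "finite F" using assms(1) finite_subset by blast
  then have "\<exists>C\<subseteq>F. circuit n \<Delta> C" using assms
  proof (induction F rule: finite_psubset_induct)
    case (psubset F)
    show ?case
    proof (cases "\<forall>D. D \<subset> F \<longrightarrow> D \<in> \<Delta>")
      case True
      then show ?thesis using psubset.prems by (auto simp: circuit_def)
    next
      case False
      then obtain D where D: "D \<subset> F" "D \<notin> \<Delta>" by blast
      then obtain C where "C \<subseteq> D" "circuit n \<Delta> C"
        using psubset.IH[of D] psubset.prems(1) by auto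
      then show ?thesis using D(1) by blast
    qed
  qed
  then show thesis using that by blast
qed

lemma girth_le_card_nonface:
  assumes "F \<subseteq> {1..n}" and "F \<notin> \<Delta>"
  shows "girth n \<Delta> \<le> card F"
proof -
  obtain C where C: "circuit n \<Delta> C" "C \<subseteq> F" using nonface_contains_circuit assms by blast
  moreover have "card C \<le> card F"
    using C(2) assms(1) by (meson card_mono finite_atLeastAtMost finite_subset)
  ultimately show ?thesis using girth_le_card le_trans by blast
qed

text \<open>A set with more elements than any face cannot be a face. Such a set provides a circuit
  and bounds the girth by the rank plus one.\<close>

lemma ex_nonface_card_Suc_rank:
  assumes "simplicial_complex n \<Delta>" and "complex_rank \<Delta> < n"
  shows "\<exists>F\<subseteq>{1..n}. F \<notin> \<Delta> \<and> card F = complex_rank \<Delta> + 1"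
proof -
  obtain F where "F \<subseteq> {1..n}" "card F = complex_rank \<Delta> + 1"
    using assms(2) obtain_subset_with_card_n[of "complex_rank \<Delta> + 1" "{1..n}"] by auto
  then show ?thesis using card_le_complex_rank[OF assms(1), of F] by auto
qed

text \<open>The hypothesis on the rank makes the set of circuits nonempty, so the \<open>Min\<close>
  in \<open>girth\<close> is attained.\<close>

lemma ex_girth_circuit:
  assumes "simplicial_complex n \<Delta>" and "complex_rank \<Delta> < n"
  obtains C where "circuit n \<Delta> C" and "card C = girth n \<Delta>"
proof -
  obtain F where "F \<subseteq> {1..n}" "F \<notin> \<Delta>" using ex_nonface_card_Suc_rank[OF assms] by blast
  then obtain C where "circuit n \<Delta> C" by (rule nonface_contains_circuit)
  then have "girth n \<Delta> \<in> card ` {C. circuit n \<Delta> C}"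
    unfolding girth_def by (intro Min_in) (auto simp: finite_circuits)
  then show thesis using that by auto
qed

lemma uniform_matroid_subset_iff:
  assumes "simplicial_complex n \<Delta>" and "complex_rank \<Delta> < n"
  shows "uniform_matroid n r \<subseteq> \<Delta> \<longleftrightarrow> r < girth n \<Delta>"
proof
  assume *: "uniform_matroid n r \<subseteq> \<Delta>"
  obtain C where "circuit n \<Delta> C" "card C = girth n \<Delta>" using ex_girth_circuit assms by blast
  moreover from this have "C \<notin> uniform_matroid n r" using * by (auto simp: circuit_def)
  ultimately show "r < girth n \<Delta>" by (simp add: uniform_matroid_def circuit_def)
next
  assume r: "r < girth n \<Delta>"
  have "F \<in> \<Delta>" if "F \<subseteq> {1..n}" "card F \<le> r" for F
    using girth_le_card_nonface[of F n \<Delta>] that r by linarith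
  then show "uniform_matroid n r \<subseteq> \<Delta>" by (auto simp: uniform_matroid_def)
qed

text \<open>The skeleton consists of subsets of \<open>{1..n}\<close> within the size bound, so one
  inclusion always holds and only the other is a condition on the complex.\<close>

lemma codim_skeleton_eq_uniform_iff:
  assumes "simplicial_complex n \<Delta>"
  shows "codim_skeleton k \<Delta> = uniform_matroid n (complex_rank \<Delta> - k)
    \<longleftrightarrow> uniform_matroid n (complex_rank \<Delta> - k) \<subseteq> \<Delta>"
  using assms unfolding codim_skeleton_def uniform_matroid_def simplicial_complex_def by blast

lemma girth_ge_2:
  assumes "matroid n \<Delta>" and "loopless n \<Delta>" and "complex_rank \<Delta> < n"
  shows "2 \<le> girth n \<Delta>"
proof -
  have "F \<in> \<Delta>" if "F \<subseteq> {1..n}" "card F \<le> 1" for F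
  proof -
    \<comment> \<open>Finiteness excludes the convention that infinite sets have \<open>card\<close>
      equal to 0.\<close>
    have "finite F" using that(1) finite_subset by blast
    then have "F = {} \<or> (\<exists>i. F = {i})"
      using that(2) by (auto simp: le_Suc_eq card_1_singleton_iff)
    then show ?thesis using assms that(1) by (auto simp: matroid_def loopless_def)
  qed
  then have "uniform_matroid n 1 \<subseteq> \<Delta>" unfolding uniform_matroid_def by auto
  then show ?thesis using assms uniform_matroid_subset_iff[of n \<Delta> 1] by (auto simp: matroid_def)
qed

theorem proposition7p6:
  fixes n c g :: nat and \<Delta> :: "nat set set"
  assumes "matroid n \<Delta>"
    and "loopless n \<Delta>"
    and "complex_rank \<Delta> = c"
    and "c < n"
    and "girth n \<Delta> = g"
  shows "\<exists>u. uniformity_threshold n \<Delta> = enat u \<and> int u = int c + 2 - int g"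
proof -
  have sc: "simplicial_complex n \<Delta>" and rank: "complex_rank \<Delta> < n"
    using assms by (auto simp: matroid_def)
  have g2: "2 \<le> g" using girth_ge_2 assms by blast
  have gc: "g \<le> c + 1"
    using ex_nonface_card_Suc_rank[OF sc rank] girth_le_card_nonface assms(3,5) by metis
  have iff: "codim_skeleton (u - 1) \<Delta> = uniform_matroid n (c - u + 1) \<longleftrightarrow> c + 2 - g \<le> u"
    if "1 \<le> u" "u \<le> c" for u
  proof -
    have "c - (u - 1) = c - u + 1" using that by simp
    then have "codim_skeleton (u - 1) \<Delta> = uniform_matroid n (c - u + 1) \<longleftrightarrow> c - u + 1 < g"
      using codim_skeleton_eq_uniform_iff[OF sc, of "u - 1"]
        uniform_matroid_subset_iff[OF sc rank, of "c - u + 1"] assms(3,5) by simp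
    \<comment> \<open>By \<open>gc\<close> the subtraction in \<open>c + 2 - g\<close> does not
      truncate.\<close>
    then show ?thesis using that gc by linarith
  qed
  \<comment> \<open>For \<open>u\<close> outside \<open>{1..c}\<close> both sides fail:
    \<open>gc\<close> gives \<open>1 \<le> c + 2 - g\<close>, which excludes
    \<open>u = 0\<close>.\<close>
  have "1 \<le> u \<and> u \<le> c \<and> codim_skeleton (u - 1) \<Delta> = uniform_matroid n (c - u + 1)
      \<longleftrightarrow> u \<in> {c + 2 - g..c}" for u
    using iff[of u] gc by (cases "1 \<le> u \<and> u \<le> c") auto
  then have "uniformity_threshold n \<Delta> = Inf (enat ` {c + 2 - g..c})"
    unfolding uniformity_threshold_def assms(3) image_def Bex_def by (simp only: conj_commute)
  also have "\<dots> = enat (c + 2 - g)"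
    \<comment> \<open>By \<open>g2\<close> the lower end is at most \<open>c\<close>, so it belongs
      to the interval; an empty interval would give infinity.\<close>
    using g2 gc by (intro antisym Inf_lower Inf_greatest) auto
  finally show ?thesis using gc by (intro exI[of _ "c + 2 - g"]) auto
qed

end
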